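(* Let $Y$ be a metrizable topological space. The following conditions are equivalent: (i) $Y$ has the almost everywhere equality property (AEEP); (ii) the topological weight of $Y$ is no greater than $2^{\aleph_0}$; (iii) $\operatorname{card}(Y) \leqslant 2^{\aleph_0}$.
   Context: For a topological space $Y$, $\mathfrak{B}(Y)$ denotes the $\sigma$-algebra of all Borel subsets of $Y$, i.e. the smallest $\sigma$-algebra containing all open sets. A measurable space is a pair $(X,\mathfrak{M})$ where $\mathfrak{M}$ is a $\sigma$-algebra of subsets of the set $X$. A function $f\colon (X,\mathfrak{M}) \to Y$ is measurable if $f^{-1}(U) \in \mathfrak{M}$ for every open set $U \subset Y$ (equivalently, $f^{-1}(B) \in \mathfrak{M}$ for every $B \in \mathfrak{B}(Y)$). A topological space $Y$ has the almost everywhere equality property (AEEP) if, whenever $(X,\mathfrak{M})$ is a measurable space and $f,g\colon X \to Y$ are two measurable functions, the set $\Delta(f,g) = \{x \in X : f(x) = g(x)\}$ is a member of $\mathfrak{M}$. $\operatorname{card}(Y)$ denotes the cardinality of $Y$. The topological weight of $Y$ is the least cardinality of a base of the topology of $Y$. *)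

theory Defs
  imports "HOL-Analysis.Analysis"
begin

unbundle cardinal_syntax

definition borel_of :: "'a topology \<Rightarrow> 'a measure" where
  "borel_of Y = sigma (topspace Y) {U. openin Y U}"

lemma measurable_borel_of_iff:
  "f \<in> M \<rightarrow>\<^sub>M borel_of Y \<longleftrightarrow>
     f \<in> space M \<rightarrow> topspace Y \<and> (\<forall>U. openin Y U \<longrightarrow> f -` U \<inter> space M \<in> sets M)"
proof -
  have sub: "{U. openin Y U} \<subseteq> Pow (topspace Y)"
    using openin_subset by auto
  have "f -` U \<inter> space M \<in> sets M" if "f \<in> M \<rightarrow>\<^sub>M borel_of Y" "openin Y U" for U
    using measurable_sets[OF that(1)] that(2) in_measure_of[OF sub]
    by (simp add: borel_of_def)
  moreover have "f \<in> space M \<rightarrow> topspace Y" if "f \<in> M \<rightarrow>\<^sub>M borel_of Y"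
    using measurable_space[OF that] sub by (simp add: borel_of_def space_measure_of)
  moreover have "f \<in> M \<rightarrow>\<^sub>M borel_of Y"
    if "f \<in> space M \<rightarrow> topspace Y" "\<forall>U. openin Y U \<longrightarrow> f -` U \<inter> space M \<in> sets M"
    unfolding borel_of_def
    by (rule measurable_measure_of) (use sub that in auto)
  ultimately show ?thesis by blast
qed

(* HOL cannot quantify over types inside a formula, so the type from which the underlying sets
   X of the measurable spaces are drawn is a parameter. A measurable space (X, \<MM>) is a value
   M with X = space M (any subset of the type) and \<MM> = sets M; the measure carried
   by M plays no role. *)
definition AEEP :: "'x itself \<Rightarrow> 'a topology \<Rightarrow> bool" where
  "AEEP _ Y \<longleftrightarrow>
     (\<forall>(M :: 'x measure) f g. f \<in> M \<rightarrow>\<^sub>M borel_of Y \<longrightarrow> g \<in> M \<rightarrow>\<^sub>M borel_of Y \<longrightarrow>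
        {x \<in> space M. f x = g x} \<in> sets M)"

definition topology_base :: "'a topology \<Rightarrow> 'a set set \<Rightarrow> bool" where
  "topology_base Y \<B> \<longleftrightarrow>
     (\<forall>V\<in>\<B>. openin Y V) \<and> (\<forall>U. openin Y U \<longrightarrow> (\<exists>\<C>\<subseteq>\<B>. U = \<Union>\<C>))"

(* As usual for HOL cardinals, the weight is unique only up to =o. *)
definition weight :: "'a topology \<Rightarrow> 'a set rel" where
  "weight Y = card_of (SOME \<B>. topology_base Y \<B> \<and> (\<forall>\<B>'. topology_base Y \<B>' \<longrightarrow> |\<B>| \<le>o |\<B>'| ))"

lemma weight_least:
  shows "\<exists>\<B>. topology_base Y \<B> \<and> weight Y = |\<B>|"
    and "topology_base Y \<B>' \<Longrightarrow> weight Y \<le>o |\<B>'|"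
proof -
  let ?R = "card_of ` {\<B>. topology_base Y \<B>}"
  have "topology_base Y {U. openin Y U}"
    unfolding topology_base_def by (auto intro!: exI[where x = "{U}" for U])
  then have "?R \<noteq> {}" by blast
  moreover have "\<forall>r\<in>?R. Card_order r"
    by (auto simp: card_of_Card_order)
  ultimately have "\<exists>r\<in>?R. \<forall>r'\<in>?R. r \<le>o r'"
    by (rule exists_minim_Card_order)
  then have "\<exists>\<B>. topology_base Y \<B> \<and> (\<forall>\<B>'. topology_base Y \<B>' \<longrightarrow> |\<B>| \<le>o |\<B>'| )"
    by auto
  from someI_ex[OF this]
  show "\<exists>\<B>. topology_base Y \<B> \<and> weight Y = |\<B>|"
    and "topology_base Y \<B>' \<Longrightarrow> weight Y \<le>o |\<B>'|"
    unfolding weight_def by blast+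
qed

end

theory Submission
  imports Defs
begin

text \<open>
  The bridge between the three conditions is the existence of countably many sets that separate
  the points of \<open>Y\<close>, equivalently of an injection of \<open>Y\<close> into the subsets of \<open>\<nat>\<close>.

  If \<open>Y\<close> has AEEP, the two projections of \<open>Y \<times> Y\<close> with the product of the Borel algebras show that
  the diagonal lies in that product. A member of a product algebra is built from countably many
  rectangles, so the first sides of those rectangles already separate the points of \<open>Y\<close>
  (\<open>sets_pair_measure_countably_determined\<close>), and \<open>Y\<close> has at most continuum many points.

  Conversely, let \<open>Y\<close> have at most continuum many points. For a separable space a countable base
  would separate points by Borel sets; in general such sets come from an idea of Stone and
  Montgomery. Well-order \<open>Y\<close> and send each \<open>z\<close> to the first point \<open>p z\<close> at distance less than
  \<open>\<epsilon>\<close>. The preimage under \<open>p\<close> of every set, however wild, is an \<open>F\<^sub>\<sigma>\<close> set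
  (\<open>borel_nearby_point\<close>): the fibres of \<open>p\<close>, shrunk slightly, are closed and a fixed positive
  distance apart. Reading off the bits of a code of \<open>p z\<close> as a subset of \<open>\<nat>\<close>, for \<open>\<epsilon>\<close> running
  through a null sequence, gives a countable separating family of Borel sets. With such a family
  the set where \<open>f\<close> and \<open>g\<close> agree is a countable intersection of measurable sets, on any measurable
  space.

  Cardinality and weight control each other because a point is determined by a sequence of basic
  sets shrinking to it, there being only continuum many sequences of elements of a set of
  cardinality at most the continuum, and because the balls of radius \<open>1/(n+1)\<close> form a base.
\<close>

section \<open>Cardinality at most the continuum\<close>

lemma ordLeq_continuum_iff:
  fixes A :: "'a set"
  shows "|A| \<le>o ctwo ^c natLeq \<longleftrightarrow> (\<exists>f :: 'a \<Rightarrow> nat set. inj_on f A)"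
proof -
  have "|UNIV :: nat set set| =o ctwo ^c natLeq"
    using card_of_Pow_Func[of "UNIV :: nat set"]
    by (simp add: cexp_def ctwo_def Field_card_of Field_natLeq)
  then have "|A| \<le>o ctwo ^c natLeq \<longleftrightarrow> |A| \<le>o |UNIV :: nat set set|"
    using ordLeq_ordIso_trans ordIso_symmetric by metis
  also have "\<dots> \<longleftrightarrow> (\<exists>f :: 'a \<Rightarrow> nat set. inj_on f A)"
    by (simp add: card_of_ordLeq[symmetric])
  finally show ?thesis .
qed

section \<open>From the almost everywhere equality property to cardinality\<close>

text \<open>The membership of \<open>(y, z)\<close> in \<open>S\<close> depends on \<open>y\<close> only through the countably many
  bits \<open>y \<in> A n\<close>, because only countably many rectangles enter the construction of \<open>S\<close>.\<close>

lemma sets_pair_measure_countably_determined: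
  assumes "S \<in> sets (M \<Otimes>\<^sub>M N)"
  shows "\<exists>A :: nat \<Rightarrow> 'a set. \<forall>y\<in>space M. \<forall>y'\<in>space M. \<forall>z\<in>space N.
           (\<forall>n. y \<in> A n \<longleftrightarrow> y' \<in> A n) \<longrightarrow> ((y, z) \<in> S \<longleftrightarrow> (y', z) \<in> S)"
  using assms unfolding sets_pair_measure
proof (induction rule: sigma_sets.induct)
  case (Basic S)
  then obtain a b where S: "S = a \<times> b" by blast
  show ?case by (rule exI[of _ "\<lambda>_. a"]) (simp add: S)
next
  case Empty
  then show ?case by simp
next
  case (Compl S)
  from Compl.IH obtain A :: "nat \<Rightarrow> 'a set" where A:
    "\<forall>y\<in>space M. \<forall>y'\<in>space M. \<forall>z\<in>space N.
       (\<forall>n. y \<in> A n \<longleftrightarrow> y' \<in> A n) \<longrightarrow> ((y, z) \<in> S \<longleftrightarrow> (y', z) \<in> S)" ..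
  show ?case
  proof (intro exI[of _ A] ballI impI)
    fix y y' z
    assume in_space: "y \<in> space M" "y' \<in> space M" "z \<in> space N"
      and "\<forall>n. y \<in> A n \<longleftrightarrow> y' \<in> A n"
    with A have "(y, z) \<in> S \<longleftrightarrow> (y', z) \<in> S" by metis
    with in_space show "(y, z) \<in> space M \<times> space N - S \<longleftrightarrow> (y', z) \<in> space M \<times> space N - S"
      by simp
  qed
next
  case (Union S)
  from Union.IH obtain A :: "nat \<Rightarrow> nat \<Rightarrow> 'a set" where A:
    "\<And>i y y' z. \<lbrakk>y \<in> space M; y' \<in> space M; z \<in> space N; \<forall>n. y \<in> A i n \<longleftrightarrow> y' \<in> A i n\<rbrakk>
       \<Longrightarrow> (y, z) \<in> S i \<longleftrightarrow> (y', z) \<in> S i" by metis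
  show ?case
  proof (intro exI[of _ "\<lambda>n. A (fst (prod_decode n)) (snd (prod_decode n))"] ballI impI)
    fix y y' z
    assume in_space: "y \<in> space M" "y' \<in> space M" "z \<in> space N"
      and eq: "\<forall>n. y \<in> A (fst (prod_decode n)) (snd (prod_decode n)) \<longleftrightarrow>
                   y' \<in> A (fst (prod_decode n)) (snd (prod_decode n))"
    have "y \<in> A i n \<longleftrightarrow> y' \<in> A i n" for i n
      using spec[OF eq, of "prod_encode (i, n)"] by simp
    then have "(y, z) \<in> S i \<longleftrightarrow> (y', z) \<in> S i" for i
      using A in_space by blast
    then show "(y, z) \<in> (\<Union>i. S i) \<longleftrightarrow> (y', z) \<in> (\<Union>i. S i)" by blast
  qed
qed

lemma space_borel_of [simp]: "space (borel_of Y) = topspace Y"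
  unfolding borel_of_def by (rule space_measure_of) (auto dest: openin_subset)

text \<open>The product of the Borel algebra with itself is the smallest algebra for which both projections
  are measurable, so it is the decisive test space, and its points have type \<open>'a \<times> 'a\<close>. If \<open>y\<close> and
  \<open>y'\<close> have the same bits, then \<open>(y', y)\<close> lies on the diagonal because \<open>(y, y)\<close> does.\<close>

lemma AEEP_imp_card_le_continuum:
  fixes Y :: "'a topology"
  assumes "AEEP TYPE('a \<times> 'a) Y"
  shows "|topspace Y| \<le>o ctwo ^c natLeq"
proof -
  let ?P = "borel_of Y \<Otimes>\<^sub>M borel_of Y"
  have "{x \<in> space ?P. fst x = snd x} \<in> sets ?P"
    using assms unfolding AEEP_def by (meson measurable_fst measurable_snd)
  from sets_pair_measure_countably_determined[OF this] obtain A :: "nat \<Rightarrow> 'a set" where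
    A: "\<forall>y\<in>topspace Y. \<forall>y'\<in>topspace Y. \<forall>z\<in>topspace Y. (\<forall>n. y \<in> A n \<longleftrightarrow> y' \<in> A n) \<longrightarrow>
          ((y, z) \<in> {x \<in> space ?P. fst x = snd x} \<longleftrightarrow> (y', z) \<in> {x \<in> space ?P. fst x = snd x})"
    unfolding space_borel_of by blast
  have "inj_on (\<lambda>y. {n. y \<in> A n}) (topspace Y)"
  proof (rule inj_onI)
    fix y y' assume "y \<in> topspace Y" "y' \<in> topspace Y" "{n. y \<in> A n} = {n. y' \<in> A n}"
    then have "\<forall>n. y \<in> A n \<longleftrightarrow> y' \<in> A n" unfolding set_eq_iff mem_Collect_eq by blast
    then have "(y, y) \<in> {x \<in> space ?P. fst x = snd x} \<longleftrightarrow> (y', y) \<in> {x \<in> space ?P. fst x = snd x}"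
      using A \<open>y \<in> topspace Y\<close> \<open>y' \<in> topspace Y\<close> by blast
    then show "y = y'"
      using \<open>y \<in> topspace Y\<close> \<open>y' \<in> topspace Y\<close> by (simp add: space_pair_measure)
  qed
  then show ?thesis unfolding ordLeq_continuum_iff by blast
qed

section \<open>From cardinality to the almost everywhere equality property\<close>

lemma sets_borel_of_openin: "openin Y U \<Longrightarrow> U \<in> sets (borel_of Y)"
  unfolding borel_of_def by (rule in_measure_of) (auto dest: openin_subset)

lemma sets_borel_of_closedin:
  assumes "closedin Y C" shows "C \<in> sets (borel_of Y)"
proof -
  have "topspace Y - (topspace Y - C) \<in> sets (borel_of Y)"
    using sets.compl_sets[OF sets_borel_of_openin] openin_diff[OF openin_topspace assms]
    by (metis space_borel_of)
  moreover have "topspace Y - (topspace Y - C) = C"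
    using closedin_subset[OF assms] by blast
  ultimately show ?thesis by simp
qed

context Metric_space
begin

lemma closedin_Union_uniformly_separated:
  assumes closed: "\<And>i. i \<in> I \<Longrightarrow> closedin mtopology (F i)"
    and "\<delta> > 0"
    and separated: "\<And>i j z w. \<lbrakk>i \<in> I; j \<in> I; i \<noteq> j; z \<in> F i; w \<in> F j\<rbrakk> \<Longrightarrow> \<delta> \<le> d z w"
  shows "closedin mtopology (\<Union>i\<in>I. F i)"
proof (rule closedin_locally_finite_Union)
  show "closedin mtopology S" if "S \<in> F ` I" for S using that closed by blast
  have in_M: "z \<in> M" if "i \<in> I" "z \<in> F i" for i z
    using closedin_subset[OF closed[OF that(1)]] that(2) by auto
  show "locally_finite_in mtopology (F ` I)"
    unfolding locally_finite_in_def
  proof (intro conjI ballI)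
    show "\<Union> (F ` I) \<subseteq> topspace mtopology" using in_M by auto
    fix x assume "x \<in> topspace mtopology"
    then have x: "x \<in> M" by simp
    (* A ball of diameter at most \<delta> meets at most one of the sets. *)
    let ?V = "mball x (\<delta> / 2)"
    have unique: "i = j"
      if "i \<in> I" "j \<in> I" "F i \<inter> ?V \<noteq> {}" "F j \<inter> ?V \<noteq> {}" for i j
    proof (rule ccontr)
      assume "i \<noteq> j"
      from that obtain z w where zw: "z \<in> F i" "w \<in> F j" "z \<in> ?V" "w \<in> ?V" by blast
      then have "\<delta> \<le> d z w" using separated that \<open>i \<noteq> j\<close> by blast
      moreover have "d z w \<le> d x z + d x w"
        using triangle[of z x w] commute[of z x] zw by (auto simp: in_mball)
      ultimately show False using zw by (auto simp: in_mball)
    qed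
    have "finite {U \<in> F ` I. U \<inter> ?V \<noteq> {}}"
    proof (cases "\<exists>i\<in>I. F i \<inter> ?V \<noteq> {}")
      case True
      then obtain i where "i \<in> I" "F i \<inter> ?V \<noteq> {}" by blast
      then have "{U \<in> F ` I. U \<inter> ?V \<noteq> {}} \<subseteq> {F i}" using unique by blast
      then show ?thesis by (rule finite_subset) simp
    next
      case False
      then have "{U \<in> F ` I. U \<inter> ?V \<noteq> {}} = {}" by blast
      then show ?thesis by (simp only: finite.emptyI)
    qed
    then show "\<exists>V. openin mtopology V \<and> x \<in> V \<and> finite {U \<in> F ` I. U \<inter> V \<noteq> {}}"
      using x \<open>\<delta> > 0\<close> by (intro exI[of _ ?V]) auto
  qed
qed

text \<open>
  Let \<open>p z\<close> be the first point, in a well-ordering of the space, within \<open>\<epsilon>\<close> of \<open>z\<close>. The fibre of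
  \<open>p\<close> over \<open>x\<close> is the union over \<open>m\<close> of the closed sets \<open>F m x\<close> of points within \<open>\<epsilon> - 1/(m+1)\<close> of
  \<open>x\<close> and outside every earlier ball. For \<open>x\<close> before \<open>x'\<close>, a point of \<open>F m x'\<close> has distance at
  least \<open>\<epsilon>\<close> from \<open>x\<close>, hence at least \<open>1/(m+1)\<close> from \<open>F m x\<close>. So the union of the \<open>F m x\<close> over any
  set of \<open>x\<close> is closed, however large that set is.
\<close>

lemma borel_nearby_point:
  assumes "\<epsilon> > 0"
  shows "\<exists>p. (\<forall>z\<in>M. p z \<in> M \<and> d (p z) z < \<epsilon>) \<and>
             (\<forall>S. {z \<in> M. p z \<in> S} \<in> sets (borel_of mtopology))"
proof -
  obtain r where "well_order_on M r" using well_order_on by blast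
  define R where "R = r - Id"
  have wf: "wf R" and total: "\<And>x y. \<lbrakk>x \<in> M; y \<in> M; x \<noteq> y\<rbrakk> \<Longrightarrow> (x, y) \<in> R \<or> (y, x) \<in> R"
    using \<open>well_order_on M r\<close>
    by (auto simp: R_def well_order_on_def linear_order_on_def total_on_def)
  define first where "first x z \<longleftrightarrow> x \<in> M \<and> d x z < \<epsilon> \<and> (\<forall>y\<in>M. (y, x) \<in> R \<longrightarrow> \<epsilon> \<le> d y z)" for x z
  have "\<exists>x. first x z" if "z \<in> M" for z
  proof -
    have "z \<in> {x \<in> M. d x z < \<epsilon>}" using that assms by simp
    from wfE_min[OF wf this] show ?thesis
      unfolding first_def by (metis (mono_tags, lifting) mem_Collect_eq not_le)
  qed
  then obtain p where p: "\<And>z. z \<in> M \<Longrightarrow> first (p z) z" by metis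
  have first_unique: "x = y" if "first x z" "first y z" for x y z
    using that total[of x y] unfolding first_def by force
  define F where
    "F m x = mcball x (\<epsilon> - inverse (real (Suc m))) - (\<Union>y\<in>{y \<in> M. (y, x) \<in> R}. mball y \<epsilon>)" for m x
  have "closedin mtopology (F m x)" for m x
    unfolding F_def by (intro closedin_diff openin_Union) auto
  moreover have "inverse (real (Suc m)) \<le> d z w"
    if "x \<in> M" "y \<in> M" "x \<noteq> y" "z \<in> F m x" "w \<in> F m y" for m x y z w
  proof -
    have separated: "inverse (real (Suc m)) \<le> d z w"
      if "(y, x) \<in> R" "y \<in> M" "z \<in> F m x" "w \<in> F m y" for x y z w
    proof -
      from that have "\<epsilon> \<le> d y z" "d y w \<le> \<epsilon> - inverse (real (Suc m))" "z \<in> M" "w \<in> M"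
        unfolding F_def by (auto simp: in_mball in_mcball not_less)
      then show ?thesis using triangle[of y w z] \<open>y \<in> M\<close> commute[of z w] by linarith
    qed
    show ?thesis
      using total[OF that(1,2,3)] separated[of y x z w] separated[of x y w z] that commute[of z w]
      by auto
  qed
  ultimately have closed: "closedin mtopology (\<Union>x\<in>S \<inter> M. F m x)" for S m
    by (intro closedin_Union_uniformly_separated[of _ _ "inverse (real (Suc m))"]) auto
  have fibre: "first x z \<longleftrightarrow> (\<exists>m. z \<in> F m x)" if "x \<in> M" "z \<in> M" for x z
  proof
    assume z: "first x z"
    then obtain m where "inverse (real (Suc m)) < \<epsilon> - d x z"
      using reals_Archimedean[of "\<epsilon> - d x z"] by (auto simp: first_def)
    then show "\<exists>m. z \<in> F m x"
      using z that by (intro exI[of _ m]) (force simp: F_def first_def in_mball in_mcball)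
  next
    assume "\<exists>m. z \<in> F m x"
    then obtain m where m: "z \<in> F m x" ..
    moreover have "inverse (real (Suc m)) > 0" by simp
    ultimately have "d x z < \<epsilon>" unfolding F_def in_mcball Diff_iff by linarith
    with m that show "first x z" by (auto simp: F_def first_def in_mball not_less)
  qed
  have "{z \<in> M. p z \<in> S} = (\<Union>m. \<Union>x\<in>S \<inter> M. F m x)" for S
  proof (intro set_eqI iffI)
    fix z assume "z \<in> {z \<in> M. p z \<in> S}"
    then have "z \<in> M" "p z \<in> S" "first (p z) z" using p by auto
    moreover from this have "p z \<in> M" by (simp add: first_def)
    ultimately show "z \<in> (\<Union>m. \<Union>x\<in>S \<inter> M. F m x)" using fibre[of "p z" z] by blast
  next
    fix z assume "z \<in> (\<Union>m. \<Union>x\<in>S \<inter> M. F m x)"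
    then obtain m x where x: "x \<in> S" "x \<in> M" "z \<in> F m x" by blast
    then have "z \<in> M" by (simp add: F_def in_mcball)
    then have "x = p z" using x fibre first_unique p by blast
    with x \<open>z \<in> M\<close> show "z \<in> {z \<in> M. p z \<in> S}" by simp
  qed
  moreover have "(\<Union>m. \<Union>x\<in>S \<inter> M. F m x) \<in> sets (borel_of mtopology)" for S
    by (intro sets.countable_UN image_subsetI sets_borel_of_closedin closed)
  ultimately have "{z \<in> M. p z \<in> S} \<in> sets (borel_of mtopology)" for S by metis
  then show ?thesis using p unfolding first_def by blast
qed

text \<open>The set \<open>A n k\<close> reads bit \<open>k\<close> of the code of a point that approximates \<open>z\<close> up to \<open>1/(n+1)\<close>.
  The code itself may be arbitrarily far from Borel; \<open>borel_nearby_point\<close> absorbs this because it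
  allows every target set. Points that no \<open>A n k\<close> separates have the same approximations, hence
  distance zero.\<close>

lemma borel_separating_sequence:
  assumes "|M| \<le>o ctwo ^c natLeq"
  shows "\<exists>A :: nat \<Rightarrow> nat \<Rightarrow> 'a set. (\<forall>n k. A n k \<in> sets (borel_of mtopology)) \<and>
           (\<forall>z\<in>M. \<forall>w\<in>M. (\<forall>n k. z \<in> A n k \<longleftrightarrow> w \<in> A n k) \<longrightarrow> z = w)"
proof -
  obtain code :: "'a \<Rightarrow> nat set" where code: "inj_on code M"
    using assms ordLeq_continuum_iff by blast
  have "\<forall>n. \<exists>p. (\<forall>z\<in>M. p z \<in> M \<and> d (p z) z < inverse (real (Suc n))) \<and>
             (\<forall>S. {z \<in> M. p z \<in> S} \<in> sets (borel_of mtopology))"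
    by (intro allI borel_nearby_point) simp
  then obtain p where p: "\<And>n z. z \<in> M \<Longrightarrow> p n z \<in> M \<and> d (p n z) z < inverse (real (Suc n))"
    and borel: "\<And>n S. {z \<in> M. p n z \<in> S} \<in> sets (borel_of mtopology)" by metis
  define A where "A n k = {z \<in> M. p n z \<in> {x. k \<in> code x}}" for n k
  have "z = w" if z: "z \<in> M" and w: "w \<in> M" and eq: "\<forall>n k. z \<in> A n k \<longleftrightarrow> w \<in> A n k" for z w
  proof (rule ccontr)
    assume "z \<noteq> w"
    then obtain n where n: "inverse (real (Suc n)) < d z w / 2"
      using reals_Archimedean[of "d z w / 2"] mdist_pos_less[of z w] z w by auto
    have "code (p n z) = code (p n w)" using eq z w by (auto simp: A_def)
    then have "p n z = p n w" using code p z w by (auto dest: inj_onD)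
    then have "d z w < inverse (real (Suc n)) + inverse (real (Suc n))"
      using p[OF z, of n] p[OF w, of n] triangle[of z "p n z" w] commute[of z "p n z"] z w by auto
    with n show False by simp
  qed
  moreover have "A n k \<in> sets (borel_of mtopology)" for n k
    unfolding A_def by (rule borel)
  ultimately show ?thesis by blast
qed

end

lemma AEEP_if_card_le_continuum:
  fixes Y :: "'a topology"
  assumes "metrizable_space Y" "|topspace Y| \<le>o ctwo ^c natLeq"
  shows "AEEP TYPE('x) Y"
  unfolding AEEP_def
proof (intro allI impI)
  fix M :: "'x measure" and f g
  assume f: "f \<in> M \<rightarrow>\<^sub>M borel_of Y" and g: "g \<in> M \<rightarrow>\<^sub>M borel_of Y"
  obtain S d where "Metric_space S d" and Y: "Y = Metric_space.mtopology S d"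
    using assms(1) by (auto simp: metrizable_space_def)
  then interpret Metric_space S d by simp
  obtain A :: "nat \<Rightarrow> nat \<Rightarrow> 'a set" where A: "\<And>n k. A n k \<in> sets (borel_of Y)"
    and separating: "\<And>z w. \<lbrakk>z \<in> S; w \<in> S; \<forall>n k. z \<in> A n k \<longleftrightarrow> w \<in> A n k\<rbrakk> \<Longrightarrow> z = w"
    using borel_separating_sequence assms(2) unfolding Y topspace_mtopology by metis
  have "f x \<in> S" "g x \<in> S" if "x \<in> space M" for x
    using measurable_space[OF f that] measurable_space[OF g that] by (auto simp: Y)
  then have "{x \<in> space M. f x = g x} = {x \<in> space M. \<forall>n k. f x \<in> A n k \<longleftrightarrow> g x \<in> A n k}"
    using separating by auto
  also have "\<dots> \<in> sets M"
  proof -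
    have [measurable]: "f \<in> M \<rightarrow>\<^sub>M borel_of Y" "g \<in> M \<rightarrow>\<^sub>M borel_of Y" by fact+
    note A [measurable]
    show ?thesis by measurable
  qed
  finally show "{x \<in> space M. f x = g x} \<in> sets M" .
qed

section \<open>Weight and cardinality\<close>

lemma weight_le_continuum_if_card_le_continuum:
  assumes "metrizable_space Y" "|topspace Y| \<le>o ctwo ^c natLeq"
  shows "weight Y \<le>o ctwo ^c natLeq"
proof -
  obtain M d where "Metric_space M d" and Y: "Y = Metric_space.mtopology M d"
    using assms(1) by (auto simp: metrizable_space_def)
  then interpret Metric_space M d by simp
  define ball where "ball = (\<lambda>(x, n). mball x (inverse (real (Suc n))))"
  let ?B = "ball ` (M \<times> UNIV)"
  have "topology_base Y ?B"
    unfolding topology_base_def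
  proof (intro conjI ballI allI impI)
    show "openin Y V" if "V \<in> ?B" for V using that by (auto simp: Y ball_def)
    fix U assume "openin Y U"
    have "\<exists>V\<in>?B. x \<in> V \<and> V \<subseteq> U" if "x \<in> U" for x
    proof -
      from \<open>openin Y U\<close> that obtain e where "e > 0" "mball x e \<subseteq> U" and x: "x \<in> M"
        unfolding Y openin_mtopology by blast
      then obtain n where n: "inverse (real (Suc n)) < e" using reals_Archimedean by blast
      then have "mball x (inverse (real (Suc n))) \<subseteq> mball x e" by (intro mball_subset_concentric) simp
      with \<open>mball x e \<subseteq> U\<close> x show ?thesis by (intro bexI[of _ "ball (x, n)"]) (auto simp: ball_def)
    qed
    then have "U = \<Union>{V \<in> ?B. V \<subseteq> U}" by blast
    then show "\<exists>\<C>\<subseteq>?B. U = \<Union>\<C>" by (intro exI[of _ "{V \<in> ?B. V \<subseteq> U}"]) auto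
  qed
  then have "weight Y \<le>o |?B|" by (rule weight_least)
  also have "|?B| \<le>o |M \<times> (UNIV :: nat set)|" by (rule card_of_image)
  also have "|M \<times> (UNIV :: nat set)| \<le>o ctwo ^c natLeq"
  proof -
    obtain code :: "'a \<Rightarrow> nat set" where code: "inj_on code M"
      using assms(2) by (auto simp: Y ordLeq_continuum_iff)
    (* The only even member stores the index n; the odd members store the code of x. *)
    have "inj_on (\<lambda>(x, n). insert (2 * n) ((\<lambda>k. 2 * k + 1) ` code x)) (M \<times> (UNIV :: nat set))"
    proof (rule inj_onI, clarify)
      fix x y and n m :: nat
      assume xy: "x \<in> M" "y \<in> M"
        and "insert (2 * n) ((\<lambda>k. 2 * k + 1) ` code x) = insert (2 * m) ((\<lambda>k. 2 * k + 1) ` code y)"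
      then have eq: "\<And>j. (j = 2 * n \<or> j \<in> (\<lambda>k. 2 * k + 1) ` code x) \<longleftrightarrow>
                         (j = 2 * m \<or> j \<in> (\<lambda>k. 2 * k + 1) ` code y)"
        unfolding set_eq_iff insert_iff by blast
      have "n = m" using eq[of "2 * n"] by (auto, presburger)
      moreover have "k \<in> code x \<longleftrightarrow> k \<in> code y" for k
        using eq[of "2 * k + 1"] by (auto simp: image_iff, presburger+)
      ultimately show "x = y \<and> n = m" using code xy by (auto dest: inj_onD)
    qed
    then show ?thesis unfolding ordLeq_continuum_iff by blast
  qed
  finally show ?thesis .
qed

text \<open>A point is determined by a choice, for each \<open>n\<close>, of a basic neighbourhood of it inside the ball
  of radius \<open>1/(n+1)\<close>. When basic sets are coded by subsets of \<open>\<nat>\<close>, such a sequence is coded by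
  a subset of \<open>\<nat> \<times> \<nat>\<close>.\<close>

lemma card_le_continuum_if_weight_le_continuum:
  fixes Y :: "'a topology"
  assumes "metrizable_space Y" "weight Y \<le>o ctwo ^c natLeq"
  shows "|topspace Y| \<le>o ctwo ^c natLeq"
proof -
  obtain M d where "Metric_space M d" and Y: "Y = Metric_space.mtopology M d"
    using assms(1) by (auto simp: metrizable_space_def)
  then interpret Metric_space M d by simp
  obtain B where base: "topology_base Y B" and "weight Y = |B|" using weight_least(1) by blast
  then obtain code :: "'a set \<Rightarrow> nat set" where code: "inj_on code B"
    using assms(2) ordLeq_continuum_iff by metis
  define basic_nbhd where
    "basic_nbhd y n V \<longleftrightarrow> V \<in> B \<and> y \<in> V \<and> V \<subseteq> mball y (inverse (real (Suc n)))" for y n V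
  have "\<exists>V. basic_nbhd y n V" if "y \<in> M" for y n
  proof -
    have "openin Y (mball y (inverse (real (Suc n))))" by (simp add: Y)
    then obtain C where "C \<subseteq> B" "mball y (inverse (real (Suc n))) = \<Union>C"
      using base unfolding topology_base_def by meson
    moreover have "y \<in> mball y (inverse (real (Suc n)))" using that by simp
    ultimately show ?thesis unfolding basic_nbhd_def by blast
  qed
  then obtain V where "\<And>y n. y \<in> M \<Longrightarrow> basic_nbhd y n (V y n)" by metis
  then have V: "\<And>y n. y \<in> M \<Longrightarrow>
      V y n \<in> B \<and> y \<in> V y n \<and> V y n \<subseteq> mball y (inverse (real (Suc n)))"
    unfolding basic_nbhd_def by blast
  have "inj_on (\<lambda>y. prod_encode ` {(n, k). k \<in> code (V y n)}) M"
  proof (rule inj_onI)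
    fix y z
    assume y: "y \<in> M" and z: "z \<in> M"
      and eq: "prod_encode ` {(n, k). k \<in> code (V y n)} = prod_encode ` {(n, k). k \<in> code (V z n)}"
    have pairs: "{(n, k). k \<in> code (V y n)} = {(n, k). k \<in> code (V z n)}"
      by (rule inj_image_eq_iff[OF inj_prod_encode, THEN iffD1, OF eq])
    have "k \<in> code (V y n) \<longleftrightarrow> k \<in> code (V z n)" for n k
      using eqset_imp_iff[OF pairs, of "(n, k)"] by simp
    then have "code (V y n) = code (V z n)" for n by (intro set_eqI)
    then have "V y n = V z n" for n using code V y z by (meson inj_onD)
    then have close: "d y z < inverse (real (Suc n))" for n
      using V[OF y, of n] V[OF z, of n] by (auto simp: in_mball)
    show "y = z"
    proof (rule ccontr)
      assume "y \<noteq> z"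
      then obtain n where "inverse (real (Suc n)) < d y z"
        using reals_Archimedean mdist_pos_less y z by blast
      with close[of n] show False by simp
    qed
  qed
  then show ?thesis unfolding Y topspace_mtopology ordLeq_continuum_iff by blast
qed

section \<open>The equivalence\<close>

theorem theorem2p7:
  fixes Y :: "'a topology"
  assumes "metrizable_space Y"
  shows "(AEEP TYPE('a \<times> 'a) Y \<longleftrightarrow> weight Y \<le>o ctwo ^c natLeq) \<and>
         (weight Y \<le>o ctwo ^c natLeq \<longleftrightarrow> |topspace Y| \<le>o ctwo ^c natLeq) \<and>
         (AEEP TYPE('a \<times> 'a) Y \<longrightarrow> AEEP TYPE('x) Y)"
  using AEEP_imp_card_le_continuum[of Y]
    AEEP_if_card_le_continuum[OF assms, where 'x = "'a \<times> 'a"]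
    AEEP_if_card_le_continuum[OF assms, where 'x = 'x]
    weight_le_continuum_if_card_le_continuum[OF assms]
    card_le_continuum_if_weight_le_continuum[OF assms]
  by blast

end
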